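(* For all extended configurations $\mathcal C_1,\mathcal C_2$: if $\mathcal C_1\approx_{\mathsf{Hasco}}\mathcal C_2$ then $\mathcal L_{\mathsf{Hasco}}(\mathcal C_1)=\mathcal L_{\mathsf{Hasco}}(\mathcal C_2)$, i.e. $\mathcal C_1$ and $\mathcal C_2$ satisfy the same closed formulae of the logic $\mathcal L_{\mathsf{Hasco}}$.
   Context: LANGUAGE. $\mathsf{Act}$ is an infinite set of actions with CCS complementation ($\bar{\bar a}=a$); $\tau\notin\mathsf{Act}$; $\mu$ ranges over $\mathsf{Act}\cup\{\tau\}$. Transaction names: $\mathsf{TrN}=\mathsf{inTrN}\uplus\mathsf{exTrN}$ (internal and external names, both infinite). Terms: $P,Q::=\sum_{i\in J}\mu_i.P_i$ ($J$ countable; $\mathbf 0$ is the empty sum) $\mid P\mid Q\mid\nu a.P\mid X\mid\mathrm{rec}X.P\mid[\![P\triangleright_kQ]\!]$ (running transaction named $k$) $\mid\mathrm{co}\mid[\![P\blacktriangleright Q]\!]$ (dormant transaction). $ftn(o)$ is the set of transaction names in $o$; $o\,\sharp\,o'$ means no transaction name of $o$ occurs in $o'$. A process is a well-formed term: (1) it is closed (no free process variables); (2) $ftn$ of it is finite; and for all subterms $[\![P_1\triangleright_kP_1']\!]$, $[\![P_2\blacktriangleright P_2']\!]$, $\sum\mu_i.Q_i$, $\mathrm{rec}X.R$: (3) $P_1,P_1',P_2,P_2',Q_i,R$ contain no transaction names; (4) $P_1,P_2,Q_i$ contain no dormant transactions; (5) $P_1,P_2$ are closed. PROCESS TRANSITIONS.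 $P\xrightarrow{\alpha}_\sigma Q$ with $\alpha\in\{a,\tau,k(\tau),k(a)\}$ and $\sigma$ a name substitution $\tilde k\mapsto l$ (domain the finite tuple $\tilde k$, possibly empty, range $\{l\}$; $\varepsilon$ alone is the empty substitution). Rules (symmetric ones omitted): - $\sum\mu_i.P_i\xrightarrow{\mu_j}_\varepsilon P_j$; - if $P\xrightarrow{a}_\varepsilon P'$ and $Q\xrightarrow{\bar a}_\varepsilon Q'$ then $P\mid Q\xrightarrow{\tau}_\varepsilon P'\mid Q'$; - $\mathrm{rec}X.P\xrightarrow{\tau}_\varepsilon P[\mathrm{rec}X.P/X]$; - if $\mu_j=a$ then $\sum\mu_i.P_i\xrightarrow{k(a)}_{\varepsilon\mapsto k}[\![P_j\mid\mathrm{co}\triangleright_k\sum\mu_i.P_i]\!]$; - if $P\xrightarrow{\mu}_\varepsilon P'$ and $k\,\sharp\,l$ then $[\![P\triangleright_lQ]\!]\xrightarrow{k(\mu)}_{l\mapsto k}[\![P'\triangleright_kQ]\!]$; - if $P\xrightarrow{k(a)}_{\sigma_1}P'$, $Q\xrightarrow{k(\bar a)}_{\sigma_2}Q'$, $\sigma_i=\tilde l_i\mapsto k$, then $P\mid Q\xrightarrow{k(\tau)}_{(\tilde l_1,\tilde l_2)\mapsto k}P'\sigma_2\mid Q'\sigma_1$; - if $P\xrightarrow{\alpha}_\sigma P'$ and $range(\sigma)\,\sharp\,Q$ then $P\mid Q\xrightarrow{\alpha}_\sigma P'\mid Q\sigma$; - if $P\xrightarrow{\alpha}_\sigma P'$ and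 $a$ does not occur in $\alpha$ then $\nu a.P\xrightarrow{\alpha}_\sigma\nu a.P'$. Reconfiguration transitions $P\xrightarrow{\beta}Q$, $\beta\in\{\mathrm{co}\,k,\mathrm{ab}\,k,\mathrm{new}\,k\}$ (symmetric rules omitted): - if $P\equiv\mathrm{co}\mid P''$ for some $P''$ and $P\rightsquigarrow_{\mathrm{co}}P'$ then $[\![P\triangleright_kQ]\!]\xrightarrow{\mathrm{co}\,k}P'$; - $[\![P\blacktriangleright Q]\!]\xrightarrow{\mathrm{new}\,k}[\![P\triangleright_kQ]\!]$; - $[\![P\triangleright_kQ]\!]\xrightarrow{\mathrm{ab}\,k}Q$; - for $\beta=\mathrm{co}\,k$ or $\mathrm{ab}\,k$: if $P\xrightarrow{\beta}P'$ and $Q\xrightarrow{\beta}Q'$ then $P\mid Q\xrightarrow{\beta}P'\mid Q'$; - if $P\xrightarrow{\beta}P'$ and $\beta\,\sharp\,Q$ then $P\mid Q\xrightarrow{\beta}P'\mid Q$; - if $P\xrightarrow{\beta}P'$ then $\nu a.P\xrightarrow{\beta}\nu a.P'$. Here $\equiv$ is standard CCS structural equivalence extended to transactions, and $\rightsquigarrow_{\mathrm{co}}$ is given by: $\mathrm{co}\rightsquigarrow_{\mathrm{co}}\mathbf 0$; sums, variables, $\mathrm{rec}X.P$ and $[\![P\blacktriangleright Q]\!]$ are related to themselves; it is compatible with $\nu a.-$ and $-\mid-$. EXTENDED CONFIGURATIONS AND $\approx_{\mathsf{Hasco}}$. $I$ is a countable index set. An extended configuration is $\langle E;H\bullet P\rangle$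 with $P$ a process, $E$ an equivalence relation over a finite subset of $\mathsf{TrN}$, and $H$ a finite partial function from $I$ to $\{k(a),k(\mathrm{ab}),k(\mathrm{co})\mid k\in\mathsf{exTrN},a\in\mathsf{Act}\}$. Let $H^{\mathrm{trn}}(i)$ be the name used in $H(i)$, $H^{\mathrm{trn}}$ the set of all these, and $\mathrm{Hasco}(H)=\{k\mid\exists i.\,H(i)=k(\mathrm{co})\}$. It is required that: (i) $H^{\mathrm{trn}}(i)=H^{\mathrm{trn}}(j)$ implies $i=j$; (ii) for $k\in\mathsf{exTrN}$, $k\,E\,k$ iff $k\in H^{\mathrm{trn}}$, and $k\,E\,k'$ implies ($k\in\mathrm{Hasco}(H)$ iff $k'\in\mathrm{Hasco}(H)$); (iii) $ftn(P)\cap\mathrm{Hasco}(H)=\emptyset$; (iv) $k\,E\,k'$ and $k,k'\in ftn(P)$ imply $k=k'$. Convention: external names of a configuration are those in its history, i.e. $ftn(P)\cap\mathsf{exTrN}\subseteq H^{\mathrm{trn}}$. "$H,k(a)$" denotes $H$ extended at a new index. For $\sigma=\tilde k\mapsto l$, $\sigma(E)$ is the smallest equivalence relation $F\supseteq E$ with $l\,F\,l$ and $k\,F\,l$ for all $k\in dom(\sigma)$. $(E;H)\setminus_{\mathrm{co}}k$ (resp. $\setminus_{\mathrm{ab}}k$) keeps $E$ and, for every $k'\,E\,k$, changes each $k'(a)$ in $H$ to $k'(\mathrm{co})$ (resp. $k'(\mathrm{ab})$). With $\Delta=E;H$, the extended transitions (labels $\zeta\in\{\tau,k(a)\}$) between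 extended configurations are: - $\langle\Delta\bullet P\rangle\xrightarrow{\tau}_e\langle\Delta\bullet Q\rangle$ if $P\xrightarrow{\tau}_\varepsilon Q$; - $\xrightarrow{\tau}_e\langle\sigma(E);H\bullet Q\rangle$ if $P\xrightarrow{k(\tau)}_\sigma Q$, $k\,\sharp\,E,H$, $k\in\mathsf{inTrN}$; - $\xrightarrow{\tau}_e\langle\Delta\bullet Q\rangle$ if $P\xrightarrow{\mathrm{new}\,k}Q$, $k\,\sharp\,\Delta$, $k\in\mathsf{inTrN}$; - $\xrightarrow{\tau}_e\langle\Delta\setminus_{\mathrm{co}}k\bullet Q\rangle$ if $P\xrightarrow{\mathrm{co}\,k}Q$; - $\xrightarrow{\tau}_e\langle\Delta\setminus_{\mathrm{ab}}k\bullet Q\rangle$ if $P\xrightarrow{\mathrm{ab}\,k}Q$; - $\xrightarrow{k(a)}_e\langle\sigma(E);H,k(a)\bullet Q\rangle$ if $P\xrightarrow{k(a)}_\sigma Q$, $k\,\sharp\,E,H$, $k\in\mathsf{exTrN}$; - $\xrightarrow{k(a)}_e\langle E,(k,k);H,k(\mathrm{ab})\bullet P\rangle$ if $k\,\sharp\,E,H,P$, $k\in\mathsf{exTrN}$. $\stackrel{\tau}{\Rightarrow}_e$ is $(\xrightarrow{\tau}_e)^*$ and $\stackrel{\zeta}{\Rightarrow}_e$ is $\stackrel{\tau}{\Rightarrow}_e\xrightarrow{\zeta}_e\stackrel{\tau}{\Rightarrow}_e$ otherwise. A relation $\mathcal R$ on extended configurations is a $\mathsf{Hasco}$-bisimulation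 if $\mathcal C_1\mathcal R\mathcal C_2$ implies: $\mathrm{Hasco}(\mathcal C_1)=\mathrm{Hasco}(\mathcal C_2)$ (the $\mathrm{Hasco}$ sets of their histories); and if $\mathcal C_1\stackrel{\zeta}{\Rightarrow}_e\mathcal C_1'$ with $\zeta\,\sharp\,\mathcal C_2$ then $\mathcal C_2\stackrel{\zeta}{\Rightarrow}_e\mathcal C_2'$ for some $\mathcal C_2'$ with $\mathcal C_1'\mathcal R\mathcal C_2'$; and conversely. $\approx_{\mathsf{Hasco}}$ is the largest one. LOGIC $\mathcal L_{\mathsf{Hasco}}$. $\mathsf{Var}$ is a countable set of variables disjoint from $\mathsf{exTrN}$. Formulae: $\phi::=\langle\tau\rangle\phi\mid\langle x(a)\rangle\phi\mid\neg\phi\mid\bigwedge_{i\in K}\phi_i$ ($K$ an arbitrary index set) $\mid\mathtt{Hasco}(v)$, with $x\in\mathsf{Var}$, $a\in\mathsf{Act}$, $v\in\mathsf{exTrN}\cup\mathsf{Var}$; $\langle x(a)\rangle\phi$ binds $x$ in $\phi$; closed formulae have no free variables (they may contain names, even infinitely many). Satisfaction for closed formulae: $\mathcal C\models\mathtt{Hasco}(k)$ iff $k\in\mathrm{Hasco}(\mathcal C)$; $\mathcal C\models\langle\tau\rangle\phi$ iff $\mathcal C\stackrel{\tau}{\Rightarrow}_e\mathcal C'$ with $\mathcal C'\models\phi$ for some $\mathcal C'$; $\mathcal C\models\langle x(a)\rangle\phi$ iff there is a cofinite $N\subseteq\mathsf{exTrN}$ such that for all $l\in N$ there is $\mathcal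 C'$ with $\mathcal C\stackrel{l(a)}{\Rightarrow}_e\mathcal C'$ and $\mathcal C'\models\phi[l/x]$; conjunction and negation are standard. $\mathcal L_{\mathsf{Hasco}}(\mathcal C)$ is the set of closed $\phi$ with $\mathcal C\models\phi$. *)

theory Defs
  imports Main "HOL-Library.Countable"
begin

section \<open>Terms\<close>

text \<open>
  Channel names bound by a restriction and process variables bound by a recursion are represented
  by de Bruijn indices (two separate index spaces), so terms are identified up to renaming of bound
  names and variables. Named terms would not do: a countable sum may mention every name, and then
  no fresh name is left for a capture-avoiding substitution. Free channel names are drawn from
  \<open>'n\<close>.
\<close>

datatype 'n chan = Free 'n | Bound nat

text \<open>The set of actions \<open>Act\<close> is the type \<open>'n act\<close>: names and co-names.\<close>

datatype 'c act = Pos 'c | Neg 'c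

primrec bar :: "'c act \<Rightarrow> 'c act" where
  "bar (Pos c) = Neg c"
| "bar (Neg c) = Pos c"

datatype 'c pref = Vis "'c act" | Tau

text \<open>
  In \<open>Choice F\<close> the countable index set of the sum is the domain of \<open>F\<close>, with the natural numbers
  as universe of indices. The set function \<open>ftn\<close> generated for the parameter \<open>'t\<close> collects all
  transaction names of a term; \<open>map_proc id f\<close> renames them.
\<close>

datatype ('n, ftn: 't) proc =
    Choice "nat \<Rightarrow> ('n chan pref \<times> ('n, 't) proc) option"
  | Par "('n, 't) proc" "('n, 't) proc"
  | Res "('n, 't) proc"
  | PVar nat
  | Rec "('n, 't) proc"
  | Run 't "('n, 't) proc" "('n, 't) proc"    \<comment> \<open>\<open>Run k P Q\<close>: running transaction named \<open>k\<close>, default \<open>P\<close>, alternative \<open>Q\<close>\<close>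
  | Co
  | Dorm "('n, 't) proc" "('n, 't) proc"      \<comment> \<open>dormant transaction\<close>
  for map: map_proc

definition nil :: "('n, 't) proc" where
  "nil = Choice (\<lambda>_. None)"

subsection \<open>Renaming and substitution\<close>

primrec ren_chan :: "(nat \<Rightarrow> nat) \<Rightarrow> 'n chan \<Rightarrow> 'n chan" where
  "ren_chan f (Free c) = Free c"
| "ren_chan f (Bound n) = Bound (f n)"

definition up :: "(nat \<Rightarrow> nat) \<Rightarrow> nat \<Rightarrow> nat" where
  "up f n = (case n of 0 \<Rightarrow> 0 | Suc m \<Rightarrow> Suc (f m))"

primrec ren_ch :: "('n, 't) proc \<Rightarrow> (nat \<Rightarrow> nat) \<Rightarrow> ('n, 't) proc" where
  "ren_ch (Choice F) f =
     Choice (map_option (map_prod (map_pref (ren_chan f)) (\<lambda>P. ren_ch P f)) \<circ> F)"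
| "ren_ch (Par P Q) f = Par (ren_ch P f) (ren_ch Q f)"
| "ren_ch (Res P) f = Res (ren_ch P (up f))"
| "ren_ch (PVar n) f = PVar n"
| "ren_ch (Rec P) f = Rec (ren_ch P f)"
| "ren_ch (Run k P Q) f = Run k (ren_ch P f) (ren_ch Q f)"
| "ren_ch Co f = Co"
| "ren_ch (Dorm P Q) f = Dorm (ren_ch P f) (ren_ch Q f)"

primrec ren_pv :: "('n, 't) proc \<Rightarrow> (nat \<Rightarrow> nat) \<Rightarrow> ('n, 't) proc" where
  "ren_pv (Choice F) f = Choice (map_option (map_prod id (\<lambda>P. ren_pv P f)) \<circ> F)"
| "ren_pv (Par P Q) f = Par (ren_pv P f) (ren_pv Q f)"
| "ren_pv (Res P) f = Res (ren_pv P f)"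
| "ren_pv (PVar n) f = PVar (f n)"
| "ren_pv (Rec P) f = Rec (ren_pv P (up f))"
| "ren_pv (Run k P Q) f = Run k (ren_pv P f) (ren_pv Q f)"
| "ren_pv Co f = Co"
| "ren_pv (Dorm P Q) f = Dorm (ren_pv P f) (ren_pv Q f)"

text \<open>
  \<open>psubst P n Q\<close> replaces variable \<open>n\<close> of \<open>P\<close> by \<open>Q\<close> and removes the binder \<open>n\<close> referred to.
  Moving \<open>Q\<close> under a binder shifts its indices, which makes the substitution capture-avoiding.
\<close>

primrec psubst :: "('n, 't) proc \<Rightarrow> nat \<Rightarrow> ('n, 't) proc \<Rightarrow> ('n, 't) proc" where
  "psubst (Choice F) n Q = Choice (map_option (map_prod id (\<lambda>P. psubst P n Q)) \<circ> F)"
| "psubst (Par P R) n Q = Par (psubst P n Q) (psubst R n Q)"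
| "psubst (Res P) n Q = Res (psubst P n (ren_ch Q Suc))"
| "psubst (PVar m) n Q = (if m < n then PVar m else if m = n then Q else PVar (m - 1))"
| "psubst (Rec P) n Q = Rec (psubst P (Suc n) (ren_pv Q Suc))"
| "psubst (Run k P R) n Q = Run k (psubst P n Q) (psubst R n Q)"
| "psubst Co n Q = Co"
| "psubst (Dorm P R) n Q = Dorm (psubst P n Q) (psubst R n Q)"

subsection \<open>Well-formed terms\<close>

inductive subterm :: "('n, 't) proc \<Rightarrow> ('n, 't) proc \<Rightarrow> bool" where
  "subterm P P"
| "F j = Some (\<mu>, P) \<Longrightarrow> subterm S P \<Longrightarrow> subterm S (Choice F)"
| "subterm S P \<Longrightarrow> subterm S (Par P Q)"
| "subterm S Q \<Longrightarrow> subterm S (Par P Q)"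
| "subterm S P \<Longrightarrow> subterm S (Res P)"
| "subterm S P \<Longrightarrow> subterm S (Rec P)"
| "subterm S P \<Longrightarrow> subterm S (Run k P Q)"
| "subterm S Q \<Longrightarrow> subterm S (Run k P Q)"
| "subterm S P \<Longrightarrow> subterm S (Dorm P Q)"
| "subterm S Q \<Longrightarrow> subterm S (Dorm P Q)"

inductive free_pv :: "nat \<Rightarrow> ('n, 't) proc \<Rightarrow> bool" where
  "free_pv n (PVar n)"
| "F j = Some (\<mu>, P) \<Longrightarrow> free_pv n P \<Longrightarrow> free_pv n (Choice F)"
| "free_pv n P \<Longrightarrow> free_pv n (Par P Q)"
| "free_pv n Q \<Longrightarrow> free_pv n (Par P Q)"
| "free_pv n P \<Longrightarrow> free_pv n (Res P)"
| "free_pv (Suc n) P \<Longrightarrow> free_pv n (Rec P)"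
| "free_pv n P \<Longrightarrow> free_pv n (Run k P Q)"
| "free_pv n Q \<Longrightarrow> free_pv n (Run k P Q)"
| "free_pv n P \<Longrightarrow> free_pv n (Dorm P Q)"
| "free_pv n Q \<Longrightarrow> free_pv n (Dorm P Q)"

definition pclosed :: "('n, 't) proc \<Rightarrow> bool" where
  "pclosed P \<longleftrightarrow> (\<forall>n. \<not> free_pv n P)"

text \<open>
  \<open>dangling n P\<close>: the index \<open>Bound n\<close> occurs in \<open>P\<close> without a matching restriction. Terms with
  dangling indices only arise below a restriction and have no named counterpart of their own.
\<close>

inductive dangling :: "nat \<Rightarrow> ('n, 't) proc \<Rightarrow> bool" where
  "F j = Some (\<mu>, P) \<Longrightarrow> Bound n \<in> set_pref \<mu> \<Longrightarrow> dangling n (Choice F)"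
| "F j = Some (\<mu>, P) \<Longrightarrow> dangling n P \<Longrightarrow> dangling n (Choice F)"
| "dangling n P \<Longrightarrow> dangling n (Par P Q)"
| "dangling n Q \<Longrightarrow> dangling n (Par P Q)"
| "dangling (Suc n) P \<Longrightarrow> dangling n (Res P)"
| "dangling n P \<Longrightarrow> dangling n (Rec P)"
| "dangling n P \<Longrightarrow> dangling n (Run k P Q)"
| "dangling n Q \<Longrightarrow> dangling n (Run k P Q)"
| "dangling n P \<Longrightarrow> dangling n (Dorm P Q)"
| "dangling n Q \<Longrightarrow> dangling n (Dorm P Q)"

definition no_dormant :: "('n, 't) proc \<Rightarrow> bool" where
  "no_dormant P \<longleftrightarrow> (\<nexists>A B. subterm (Dorm A B) P)"

definition process :: "('n, 't) proc \<Rightarrow> bool" where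
  "process P \<longleftrightarrow>
     (\<forall>n. \<not> dangling n P) \<and>
     pclosed P \<and>
     finite (ftn P) \<and>
     (\<forall>k A B. subterm (Run k A B) P \<longrightarrow>
        ftn A = {} \<and> ftn B = {} \<and> no_dormant A \<and> pclosed A) \<and>
     (\<forall>A B. subterm (Dorm A B) P \<longrightarrow>
        ftn A = {} \<and> ftn B = {} \<and> no_dormant A \<and> pclosed A) \<and>
     (\<forall>F j \<mu> Q. subterm (Choice F) P \<and> F j = Some (\<mu>, Q) \<longrightarrow> ftn Q = {} \<and> no_dormant Q) \<and>
     (\<forall>R. subterm (Rec R) P \<longrightarrow> ftn R = {})"

section \<open>Process transitions\<close>

text \<open>
  \<open>Merge ks l\<close> is the substitution mapping each name of the tuple \<open>ks\<close> to \<open>l\<close>. For \<open>ks = []\<close> it acts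
  as the identity but still has range \<open>{l}\<close>, unlike the empty substitution \<open>Eps\<close>.
\<close>

datatype 't tsub = Eps | Merge "'t list" 't

primrec tdom :: "'t tsub \<Rightarrow> 't set" where
  "tdom Eps = {}"
| "tdom (Merge ks l) = set ks"

primrec trange :: "'t tsub \<Rightarrow> 't set" where
  "trange Eps = {}"
| "trange (Merge ks l) = {l}"

primrec tname :: "'t tsub \<Rightarrow> 't \<Rightarrow> 't" where
  "tname Eps t = t"
| "tname (Merge ks l) t = (if t \<in> set ks then l else t)"

definition tapp :: "('n, 't) proc \<Rightarrow> 't tsub \<Rightarrow> ('n, 't) proc" where
  "tapp P \<sigma> = map_proc id (tname \<sigma>) P"

text \<open>\<open>Plain \<mu>\<close> is the label \<open>\<mu>\<close>, and \<open>At k \<mu>\<close> is the label \<open>k(\<mu>)\<close>.\<close>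

datatype ('c, 't) lab = Plain "'c pref" | At 't "'c pref"

abbreviation lift_lab :: "('n chan, 't) lab \<Rightarrow> ('n chan, 't) lab" where
  "lift_lab \<equiv> map_lab (ren_chan Suc) id"

text \<open>
  In rule \<open>res\<close> the label \<open>lift_lab \<alpha>\<close> is the label \<open>\<alpha>\<close> seen from below the restriction. As it never
  mentions \<open>Bound 0\<close>, the restricted name (in either polarity) does not occur in the label.
\<close>

inductive ptrans ::
  "('n, 't) proc \<Rightarrow> ('n chan, 't) lab \<Rightarrow> 't tsub \<Rightarrow> ('n, 't) proc \<Rightarrow> bool" where
  sum: "F j = Some (\<mu>, P) \<Longrightarrow> ptrans (Choice F) (Plain \<mu>) Eps P"
| com: "ptrans P (Plain (Vis a)) Eps P' \<Longrightarrow> ptrans Q (Plain (Vis (bar a))) Eps Q' \<Longrightarrow>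
    ptrans (Par P Q) (Plain Tau) Eps (Par P' Q')"
| rec: "ptrans (Rec P) (Plain Tau) Eps (psubst P 0 (Rec P))"
| sum_tr: "F j = Some (Vis a, P) \<Longrightarrow>
    ptrans (Choice F) (At k (Vis a)) (Merge [] k) (Run k (Par P Co) (Choice F))"
| run_tr: "ptrans P (Plain \<mu>) Eps P' \<Longrightarrow> k \<noteq> l \<Longrightarrow>
    ptrans (Run l P Q) (At k \<mu>) (Merge [l] k) (Run k P' Q)"
| com_tr: "ptrans P (At k (Vis a)) (Merge ls1 k) P' \<Longrightarrow>
    ptrans Q (At k (Vis (bar a))) (Merge ls2 k) Q' \<Longrightarrow>
    ptrans (Par P Q) (At k Tau) (Merge (ls1 @ ls2) k)
      (Par (tapp P' (Merge ls2 k)) (tapp Q' (Merge ls1 k)))"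
| par_l: "ptrans P \<alpha> \<sigma> P' \<Longrightarrow> trange \<sigma> \<inter> ftn Q = {} \<Longrightarrow>
    ptrans (Par P Q) \<alpha> \<sigma> (Par P' (tapp Q \<sigma>))"
| par_r: "ptrans Q \<alpha> \<sigma> Q' \<Longrightarrow> trange \<sigma> \<inter> ftn P = {} \<Longrightarrow>
    ptrans (Par P Q) \<alpha> \<sigma> (Par (tapp P \<sigma>) Q')"
| res: "ptrans P (lift_lab \<alpha>) \<sigma> P' \<Longrightarrow> ptrans (Res P) \<alpha> \<sigma> (Res P')"

section \<open>Reconfiguration transitions\<close>

text \<open>
  Structural equivalence: the CCS laws, closed under all operators including transactions.
  \<open>ren_ch P Suc\<close> is \<open>P\<close> moved below a restriction whose name does not occur in it; \<open>swap01\<close>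
  exchanges two adjacent restrictions. Unfolding of recursion is not a law, since it is a
  \<open>\<tau>\<close>-transition.
\<close>

definition swap01 :: "nat \<Rightarrow> nat" where
  "swap01 n = (if n = 0 then 1 else if n = 1 then 0 else n)"

inductive scong :: "('n, 't) proc \<Rightarrow> ('n, 't) proc \<Rightarrow> bool" where
  sc_refl: "scong P P"
| sc_sym: "scong P Q \<Longrightarrow> scong Q P"
| sc_trans: "scong P Q \<Longrightarrow> scong Q R \<Longrightarrow> scong P R"
| sc_par_nil: "scong (Par P nil) P"
| sc_par_comm: "scong (Par P Q) (Par Q P)"
| sc_par_assoc: "scong (Par (Par P Q) R) (Par P (Par Q R))"
| sc_res_nil: "scong (Res nil) nil"
| sc_res_swap: "scong (Res (Res P)) (Res (Res (ren_ch P swap01)))"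
| sc_res_par: "scong (Res (Par (ren_ch P Suc) Q)) (Par P (Res Q))"
| sc_sum_reindex: "bij_betw \<pi> (dom F) (dom G) \<Longrightarrow> (\<And>i. i \<in> dom F \<Longrightarrow> G (\<pi> i) = F i) \<Longrightarrow>
    scong (Choice F) (Choice G)"
| sc_sum: "(\<And>i. rel_option (rel_prod (=) scong) (F i) (G i)) \<Longrightarrow> scong (Choice F) (Choice G)"
| sc_par: "scong P P' \<Longrightarrow> scong Q Q' \<Longrightarrow> scong (Par P Q) (Par P' Q')"
| sc_res: "scong P P' \<Longrightarrow> scong (Res P) (Res P')"
| sc_rec: "scong P P' \<Longrightarrow> scong (Rec P) (Rec P')"
| sc_run: "scong P P' \<Longrightarrow> scong Q Q' \<Longrightarrow> scong (Run k P Q) (Run k P' Q')"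
| sc_dorm: "scong P P' \<Longrightarrow> scong Q Q' \<Longrightarrow> scong (Dorm P Q) (Dorm P' Q')"

inductive co_erase :: "('n, 't) proc \<Rightarrow> ('n, 't) proc \<Rightarrow> bool" where
  "co_erase Co nil"
| "co_erase (Choice F) (Choice F)"
| "co_erase (PVar n) (PVar n)"
| "co_erase (Rec P) (Rec P)"
| "co_erase (Dorm P Q) (Dorm P Q)"
| "co_erase P P' \<Longrightarrow> co_erase (Res P) (Res P')"
| "co_erase P P' \<Longrightarrow> co_erase Q Q' \<Longrightarrow> co_erase (Par P Q) (Par P' Q')"

datatype 't rlab = CoL 't | AbL 't | NewL 't

primrec rname :: "'t rlab \<Rightarrow> 't" where
  "rname (CoL k) = k"
| "rname (AbL k) = k"
| "rname (NewL k) = k"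

inductive rtrans :: "('n, 't) proc \<Rightarrow> 't rlab \<Rightarrow> ('n, 't) proc \<Rightarrow> bool" where
  r_co: "scong P (Par Co P'') \<Longrightarrow> co_erase P P' \<Longrightarrow> rtrans (Run k P Q) (CoL k) P'"
| r_new: "rtrans (Dorm P Q) (NewL k) (Run k P Q)"
| r_ab: "rtrans (Run k P Q) (AbL k) Q"
| r_par: "\<beta> = CoL k \<or> \<beta> = AbL k \<Longrightarrow> rtrans P \<beta> P' \<Longrightarrow> rtrans Q \<beta> Q' \<Longrightarrow>
    rtrans (Par P Q) \<beta> (Par P' Q')"
| r_par_l: "rtrans P \<beta> P' \<Longrightarrow> rname \<beta> \<notin> ftn Q \<Longrightarrow> rtrans (Par P Q) \<beta> (Par P' Q)"
| r_par_r: "rtrans Q \<beta> Q' \<Longrightarrow> rname \<beta> \<notin> ftn P \<Longrightarrow> rtrans (Par P Q) \<beta> (Par P Q')"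
| r_res: "rtrans P \<beta> P' \<Longrightarrow> rtrans (Res P) \<beta> (Res P')"

section \<open>Extended configurations\<close>

text \<open>\<open>TrN\<close>: \<open>'i\<close> is the set of internal names, \<open>'e\<close> the set of external names.\<close>

datatype ('i, 'e) trn = InT 'i | ExT 'e

datatype 'n hact = HAct "'n act" | HAb | HCo

type_synonym ('x, 'n, 'e) hist = "'x \<rightharpoonup> 'e \<times> 'n hact"

text \<open>\<open>'x\<close> is the index set of histories.\<close>

datatype ('x, 'n, 'i, 'e) config =
  Config (ceq: "('i, 'e) trn rel") (chist: "('x, 'n, 'e) hist") (cproc: "('n, ('i, 'e) trn) proc")

definition htrn :: "('x, 'n, 'e) hist \<Rightarrow> 'e set" where
  "htrn H = fst ` ran H"

definition hasco :: "('x, 'n, 'e) hist \<Rightarrow> 'e set" where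
  "hasco H = {k. \<exists>i. H i = Some (k, HCo)}"

text \<open>
  In the second requirement on \<open>E\<close> and \<open>H\<close> both \<open>k\<close> and \<open>k'\<close> are external. Internal names never
  occur in a history, so letting \<open>k'\<close> be internal would forbid every commit of an external name that
  has been merged with an internal one.
\<close>

definition ext_config :: "('x, 'n, 'i, 'e) config \<Rightarrow> bool" where
  "ext_config C \<longleftrightarrow> (case C of Config E H P \<Rightarrow>
     process P \<and>
     (\<exists>A. finite A \<and> equiv A E) \<and>
     finite (dom H) \<and>
     (\<forall>i j k u v. H i = Some (k, u) \<and> H j = Some (k, v) \<longrightarrow> i = j) \<and>
     (\<forall>k. (ExT k, ExT k) \<in> E \<longleftrightarrow> k \<in> htrn H) \<and>
     (\<forall>k k'. (ExT k, ExT k') \<in> E \<longrightarrow> (k \<in> hasco H \<longleftrightarrow> k' \<in> hasco H)) \<and>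
     ftn P \<inter> ExT ` hasco H = {} \<and>
     (\<forall>k k'. (k, k') \<in> E \<and> k \<in> ftn P \<and> k' \<in> ftn P \<longrightarrow> k = k') \<and>
     ftn P \<inter> range ExT \<subseteq> ExT ` htrn H)"

definition eh_names :: "('i, 'e) trn rel \<Rightarrow> ('x, 'n, 'e) hist \<Rightarrow> ('i, 'e) trn set" where
  "eh_names E H = Field E \<union> ExT ` htrn H"

definition config_names :: "('x, 'n, 'i, 'e) config \<Rightarrow> ('i, 'e) trn set" where
  "config_names C = eh_names (ceq C) (chist C) \<union> ftn (cproc C)"

text \<open>
  \<open>merge \<sigma> E\<close> is \<open>\<sigma>(E)\<close>. Equivalence relations here are over subsets of \<open>TrN\<close>; they are closed
  under intersection, so this is the smallest one with the stated properties.
\<close>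

definition merge :: "('i, 'e) trn tsub \<Rightarrow> ('i, 'e) trn rel \<Rightarrow> ('i, 'e) trn rel" where
  "merge \<sigma> E = \<Inter> {F. (\<exists>A. equiv A F) \<and> E \<subseteq> F \<and>
     (\<forall>l \<in> trange \<sigma>. (l, l) \<in> F \<and> (\<forall>k \<in> tdom \<sigma>. (k, l) \<in> F))}"

text \<open>\<open>resolve u E H k\<close> is the history of \<open>(E;H)\<close> after \<open>k\<close> commits (\<open>u = HCo\<close>) or aborts (\<open>u = HAb\<close>).\<close>

definition resolve ::
  "'n hact \<Rightarrow> ('i, 'e) trn rel \<Rightarrow> ('x, 'n, 'e) hist \<Rightarrow> ('i, 'e) trn \<Rightarrow> ('x, 'n, 'e) hist" where
  "resolve u E H k = (\<lambda>i. case H i of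
       Some (k', HAct a) \<Rightarrow> if (ExT k', k) \<in> E then Some (k', u) else Some (k', HAct a)
     | r \<Rightarrow> r)"

datatype ('n, 'e) elab = ETau | EAct 'e "'n act"

inductive erule ::
  "('x, 'n, 'i, 'e) config \<Rightarrow> ('n, 'e) elab \<Rightarrow> ('x, 'n, 'i, 'e) config \<Rightarrow> bool" where
  e_tau: "ptrans P (Plain Tau) Eps Q \<Longrightarrow> erule (Config E H P) ETau (Config E H Q)"
| e_tau_tr: "ptrans P (At (InT k) Tau) \<sigma> Q \<Longrightarrow> InT k \<notin> eh_names E H \<Longrightarrow>
    erule (Config E H P) ETau (Config (merge \<sigma> E) H Q)"
| e_new: "rtrans P (NewL (InT k)) Q \<Longrightarrow> InT k \<notin> eh_names E H \<Longrightarrow>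
    erule (Config E H P) ETau (Config E H Q)"
| e_co: "rtrans P (CoL k) Q \<Longrightarrow> erule (Config E H P) ETau (Config E (resolve HCo E H k) Q)"
| e_ab: "rtrans P (AbL k) Q \<Longrightarrow> erule (Config E H P) ETau (Config E (resolve HAb E H k) Q)"
| e_act: "ptrans P (At (ExT k) (Vis (map_act Free a))) \<sigma> Q \<Longrightarrow> ExT k \<notin> eh_names E H \<Longrightarrow>
    i \<notin> dom H \<Longrightarrow>
    erule (Config E H P) (EAct k a) (Config (merge \<sigma> E) (H(i \<mapsto> (k, HAct a))) Q)"
| e_act_ab: "ExT k \<notin> eh_names E H \<Longrightarrow> ExT k \<notin> ftn P \<Longrightarrow> i \<notin> dom H \<Longrightarrow>
    erule (Config E H P) (EAct k a) (Config (insert (ExT k, ExT k) E) (H(i \<mapsto> (k, HAb))) P)"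

definition estep ::
  "('x, 'n, 'i, 'e) config \<Rightarrow> ('n, 'e) elab \<Rightarrow> ('x, 'n, 'i, 'e) config \<Rightarrow> bool" where
  "estep C \<zeta> C' \<longleftrightarrow> ext_config C \<and> ext_config C' \<and> erule C \<zeta> C'"

abbreviation taus :: "('x, 'n, 'i, 'e) config \<Rightarrow> ('x, 'n, 'i, 'e) config \<Rightarrow> bool" where
  "taus \<equiv> (\<lambda>C C'. estep C ETau C')\<^sup>*\<^sup>*"

definition weak ::
  "('x, 'n, 'i, 'e) config \<Rightarrow> ('n, 'e) elab \<Rightarrow> ('x, 'n, 'i, 'e) config \<Rightarrow> bool" where
  "weak C \<zeta> C' \<longleftrightarrow>
     (if \<zeta> = ETau then taus C C' else \<exists>D D'. taus C D \<and> estep D \<zeta> D' \<and> taus D' C')"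

section \<open>Hasco-bisimilarity\<close>

primrec elab_names :: "('n, 'e) elab \<Rightarrow> ('i, 'e) trn set" where
  "elab_names ETau = {}"
| "elab_names (EAct k a) = {ExT k}"

definition hasco_bisimulation ::
  "(('x, 'n, 'i, 'e) config \<Rightarrow> ('x, 'n, 'i, 'e) config \<Rightarrow> bool) \<Rightarrow> bool" where
  "hasco_bisimulation R \<longleftrightarrow> (\<forall>C1 C2. R C1 C2 \<longrightarrow>
     ext_config C1 \<and> ext_config C2 \<and>
     hasco (chist C1) = hasco (chist C2) \<and>
     (\<forall>\<zeta> C1'. weak C1 \<zeta> C1' \<and> elab_names \<zeta> \<inter> config_names C2 = {} \<longrightarrow>
        (\<exists>C2'. weak C2 \<zeta> C2' \<and> R C1' C2')) \<and>
     (\<forall>\<zeta> C2'. weak C2 \<zeta> C2' \<and> elab_names \<zeta> \<inter> config_names C1 = {} \<longrightarrow>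
        (\<exists>C1'. weak C1 \<zeta> C1' \<and> R C1' C2')))"

definition hasco_bisimilar ::
  "('x, 'n, 'i, 'e) config \<Rightarrow> ('x, 'n, 'i, 'e) config \<Rightarrow> bool"
  (infix "\<approx>\<^sub>H\<^sub>a\<^sub>s\<^sub>c\<^sub>o" 50) where
  "C1 \<approx>\<^sub>H\<^sub>a\<^sub>s\<^sub>c\<^sub>o C2 \<longleftrightarrow> (\<exists>R. hasco_bisimulation R \<and> R C1 C2)"

lemma hasco_bisimilar_greatest:
  "hasco_bisimulation R \<Longrightarrow> R C1 C2 \<Longrightarrow> C1 \<approx>\<^sub>H\<^sub>a\<^sub>s\<^sub>c\<^sub>o C2"
  unfolding hasco_bisimilar_def by blast

lemma hasco_bisimulation_bisimilar: "hasco_bisimulation (\<approx>\<^sub>H\<^sub>a\<^sub>s\<^sub>c\<^sub>o)"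
  unfolding hasco_bisimulation_def[of "(\<approx>\<^sub>H\<^sub>a\<^sub>s\<^sub>c\<^sub>o)"]
proof (intro allI impI)
  fix C1 C2 :: "('x, 'n, 'i, 'e) config"
  assume "C1 \<approx>\<^sub>H\<^sub>a\<^sub>s\<^sub>c\<^sub>o C2"
  then obtain R where R: "hasco_bisimulation R" and C: "R C1 C2"
    unfolding hasco_bisimilar_def by blast
  have le: "R D1 D2 \<Longrightarrow> D1 \<approx>\<^sub>H\<^sub>a\<^sub>s\<^sub>c\<^sub>o D2" for D1 D2
    by (rule hasco_bisimilar_greatest[OF R])
  note * = R[unfolded hasco_bisimulation_def, THEN spec, THEN spec, THEN mp, OF C]
  show "ext_config C1 \<and> ext_config C2 \<and>
     hasco (chist C1) = hasco (chist C2) \<and>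
     (\<forall>\<zeta> C1'. weak C1 \<zeta> C1' \<and> elab_names \<zeta> \<inter> config_names C2 = {} \<longrightarrow>
        (\<exists>C2'. weak C2 \<zeta> C2' \<and> C1' \<approx>\<^sub>H\<^sub>a\<^sub>s\<^sub>c\<^sub>o C2')) \<and>
     (\<forall>\<zeta> C2'. weak C2 \<zeta> C2' \<and> elab_names \<zeta> \<inter> config_names C1 = {} \<longrightarrow>
        (\<exists>C1'. weak C1 \<zeta> C1' \<and> C1' \<approx>\<^sub>H\<^sub>a\<^sub>s\<^sub>c\<^sub>o C2'))"
    using * by (meson le)
qed

section \<open>The logic\<close>

datatype ('e, 'v) nv = Nm 'e | Vr 'v

text \<open>
  \<open>'v\<close> is the set of variables. The index set of \<open>Conj F\<close> is the domain of \<open>F\<close>, an arbitrary subset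
  of \<open>'k\<close>; since \<open>'k\<close> is a type parameter, index sets of any size are covered.
\<close>

datatype ('n, 'e, 'v, 'k) fm =
    DiaTau "('n, 'e, 'v, 'k) fm"
  | DiaAct 'v "'n act" "('n, 'e, 'v, 'k) fm"     \<comment> \<open>\<open>\<langle>x(a)\<rangle>\<phi>\<close>, binding \<open>x\<close>\<close>
  | NegF "('n, 'e, 'v, 'k) fm"
  | Conj "'k \<Rightarrow> ('n, 'e, 'v, 'k) fm option"
  | Hasco "('e, 'v) nv"

inductive free_var :: "'v \<Rightarrow> ('n, 'e, 'v, 'k) fm \<Rightarrow> bool" where
  "free_var x \<phi> \<Longrightarrow> free_var x (DiaTau \<phi>)"
| "free_var x \<phi> \<Longrightarrow> x \<noteq> y \<Longrightarrow> free_var x (DiaAct y a \<phi>)"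
| "free_var x \<phi> \<Longrightarrow> free_var x (NegF \<phi>)"
| "F i = Some \<phi> \<Longrightarrow> free_var x \<phi> \<Longrightarrow> free_var x (Conj F)"
| "free_var x (Hasco (Vr x))"

definition fclosed :: "('n, 'e, 'v, 'k) fm \<Rightarrow> bool" where
  "fclosed \<phi> \<longleftrightarrow> (\<forall>x. \<not> free_var x \<phi>)"

primrec fsubst :: "'e \<Rightarrow> 'v \<Rightarrow> ('n, 'e, 'v, 'k) fm \<Rightarrow> ('n, 'e, 'v, 'k) fm" where
  "fsubst l x (DiaTau \<phi>) = DiaTau (fsubst l x \<phi>)"
| "fsubst l x (DiaAct y a \<phi>) = DiaAct y a (if y = x then \<phi> else fsubst l x \<phi>)"
| "fsubst l x (NegF \<phi>) = NegF (fsubst l x \<phi>)"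
| "fsubst l x (Conj F) = Conj (map_option (fsubst l x) \<circ> F)"
| "fsubst l x (Hasco v) = Hasco (if v = Vr x then Nm l else v)"

text \<open>Termination of satisfaction: \<open>\<phi>[l/x]\<close> is not a subformula of \<open>\<langle>x(a)\<rangle>\<phi>\<close>, but it is one up to names.\<close>

primrec skeleton :: "('n, 'e, 'v, 'k) fm \<Rightarrow> ('n, 'e, 'v, 'k) fm" where
  "skeleton (DiaTau \<phi>) = DiaTau (skeleton \<phi>)"
| "skeleton (DiaAct y a \<phi>) = DiaAct y a (skeleton \<phi>)"
| "skeleton (NegF \<phi>) = NegF (skeleton \<phi>)"
| "skeleton (Conj F) = Conj (map_option skeleton \<circ> F)"
| "skeleton (Hasco v) = Hasco undefined"

lemma skeleton_fsubst [simp]: "skeleton (fsubst l x \<phi>) = skeleton \<phi>"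
proof (induction \<phi>)
  case (Conj F)
  have "map_option skeleton (map_option (fsubst l x) (F i)) = map_option skeleton (F i)" for i
  proof (cases "F i")
    case (Some \<psi>)
    then have "Some \<psi> \<in> range F"
      by (intro range_eqI[of _ _ i]) simp
    then have "skeleton (fsubst l x \<psi>) = skeleton \<psi>"
      using Conj.IH by (meson option.set_intros)
    with Some show ?thesis
      by simp
  qed simp
  then show ?case
    by (simp add: fun_eq_iff)
qed auto

inductive_set imm_subfm :: "(('n, 'e, 'v, 'k) fm \<times> ('n, 'e, 'v, 'k) fm) set" where
  "(\<phi>, DiaTau \<phi>) \<in> imm_subfm"
| "(\<phi>, DiaAct x a \<phi>) \<in> imm_subfm"
| "(\<phi>, NegF \<phi>) \<in> imm_subfm"
| "F i = Some \<phi> \<Longrightarrow> (\<phi>, Conj F) \<in> imm_subfm"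

lemma imm_subfm_skeleton:
  "F i = Some \<phi> \<Longrightarrow> (skeleton \<phi>, Conj (map_option skeleton \<circ> F)) \<in> imm_subfm"
  by (rule imm_subfm.intros(4)[of _ i]) simp

lemma wf_imm_subfm: "wf imm_subfm"
  unfolding wf_def
proof (intro allI impI)
  fix P :: "('n, 'e, 'v, 'k) fm \<Rightarrow> bool" and \<phi>
  assume step: "\<forall>\<phi>. (\<forall>\<psi>. (\<psi>, \<phi>) \<in> imm_subfm \<longrightarrow> P \<psi>) \<longrightarrow> P \<phi>"
  show "P \<phi>"
  proof (induction \<phi>)
    case (Conj F)
    have "P \<psi>" if "(\<psi>, Conj F) \<in> imm_subfm" for \<psi>
      using that
    proof cases
      case (4 i)
      have "Some \<psi> \<in> range F"
        using 4 by (intro range_eqI[of _ _ i]) simp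
      then show ?thesis
        using Conj.IH by (meson option.set_intros)
    qed
    then show ?case
      using step by blast
  next
    case (DiaTau \<phi>)
    then show ?case
      using step by (blast elim: imm_subfm.cases)
  next
    case (DiaAct x a \<phi>)
    then show ?case
      using step by (blast elim: imm_subfm.cases)
  next
    case (NegF \<phi>)
    then show ?case
      using step by (blast elim: imm_subfm.cases)
  next
    case (Hasco v)
    then show ?case
      using step by (blast elim: imm_subfm.cases)
  qed
qed

text \<open>
  Satisfaction is only meant for closed formulae, on which the clause for a variable is never reached.
\<close>

function sat ::
  "('x, 'n, 'i, 'e) config \<Rightarrow> ('n, 'e, 'v, 'k) fm \<Rightarrow> bool" where
  "sat C (DiaTau \<phi>) \<longleftrightarrow> (\<exists>C'. weak C ETau C' \<and> sat C' \<phi>)"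
| "sat C (DiaAct x a \<phi>) \<longleftrightarrow>
     (\<exists>N. finite (UNIV - N) \<and> (\<forall>l \<in> N. \<exists>C'. weak C (EAct l a) C' \<and> sat C' (fsubst l x \<phi>)))"
| "sat C (NegF \<phi>) \<longleftrightarrow> \<not> sat C \<phi>"
| "sat C (Conj F) \<longleftrightarrow> (\<forall>i \<phi>. F i = Some \<phi> \<longrightarrow> sat C \<phi>)"
| "sat C (Hasco (Nm k)) \<longleftrightarrow> k \<in> hasco (chist C)"
| "sat C (Hasco (Vr x)) \<longleftrightarrow> False"
  by pat_completeness auto
termination
  by (relation "inv_image imm_subfm (\<lambda>(C, \<phi>). skeleton \<phi>)")
     (simp_all add: wf_inv_image[OF wf_imm_subfm] imm_subfm.intros imm_subfm_skeleton)

definition logic_hasco :: "('x, 'n, 'i, 'e) config \<Rightarrow> ('n, 'e, 'v, 'k) fm set" where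
  "logic_hasco C = {\<phi>. fclosed \<phi> \<and> sat C \<phi>}"

end

theory Submission
  imports Defs
begin

text \<open>
  By induction on formulae, up to the names substituted for variables. The only case that is not
  immediate is \<open>\<langle>x(a)\<rangle>\<phi>\<close>: a bisimilar configuration can only be expected to match a step labelled
  \<open>l(a)\<close> when \<open>l\<close> is fresh for it, but configurations mention finitely many names, so discarding
  those from a cofinite set of witnesses \<open>l\<close> leaves a cofinite set.
\<close>

lemma finite_config_names:
  assumes "ext_config C"
  shows "finite (config_names C)"
proof (cases C)
  case (Config E H P)
  from assms obtain A where A: "finite A" "equiv A E"
    and H: "finite (dom H)" and P: "finite (ftn P)"
    by (auto simp: ext_config_def process_def Config)
  have "E \<subseteq> A \<times> A"
    using A(2) by (rule equiv_type)
  then have "finite (Field E)"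
    using A(1) by (meson finite_Field finite_SigmaI finite_subset)
  then show ?thesis
    using H P by (simp add: Config config_names_def eh_names_def htrn_def finite_ran)
qed

text \<open>The clauses of a bisimulation treat both sides alike, so the converse of a bisimulation
  is again one. With this, it suffices to transfer each modality in one direction.\<close>

lemma hasco_bisimilar_sym:
  assumes "C1 \<approx>\<^sub>H\<^sub>a\<^sub>s\<^sub>c\<^sub>o C2"
  shows "C2 \<approx>\<^sub>H\<^sub>a\<^sub>s\<^sub>c\<^sub>o C1"
proof -
  obtain R where "hasco_bisimulation R" "R C1 C2"
    using assms unfolding hasco_bisimilar_def by blast
  then have "hasco_bisimulation R\<inverse>\<inverse>" "R\<inverse>\<inverse> C2 C1"
    unfolding hasco_bisimulation_def by simp_all
  then show ?thesis
    by (rule hasco_bisimilar_greatest)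
qed

lemma hasco_bisimilar_ext_config: "C1 \<approx>\<^sub>H\<^sub>a\<^sub>s\<^sub>c\<^sub>o C2 \<Longrightarrow> ext_config C2"
  using hasco_bisimulation_bisimilar unfolding hasco_bisimulation_def by blast

lemma hasco_bisimilar_hasco: "C1 \<approx>\<^sub>H\<^sub>a\<^sub>s\<^sub>c\<^sub>o C2 \<Longrightarrow> hasco (chist C1) = hasco (chist C2)"
  using hasco_bisimulation_bisimilar unfolding hasco_bisimulation_def by blast

lemma hasco_bisimilar_weak:
  assumes "C1 \<approx>\<^sub>H\<^sub>a\<^sub>s\<^sub>c\<^sub>o C2" "weak C1 \<zeta> C1'" "elab_names \<zeta> \<inter> config_names C2 = {}"
  obtains C2' where "weak C2 \<zeta> C2'" "C1' \<approx>\<^sub>H\<^sub>a\<^sub>s\<^sub>c\<^sub>o C2'"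
  using hasco_bisimulation_bisimilar assms unfolding hasco_bisimulation_def by blast

text \<open>The label \<open>ETau\<close> carries no names, so the freshness condition on matching
  holds trivially. The assumption \<open>transfer\<close> stands for the induction hypothesis on the
  body.\<close>

lemma sat_DiaTau_transfer:
  fixes C D :: "('x, 'n, 'i, 'e) config"
  assumes bisim: "C \<approx>\<^sub>H\<^sub>a\<^sub>s\<^sub>c\<^sub>o D" and "sat C (DiaTau \<phi>)"
    and transfer: "\<And>C' D' :: ('x, 'n, 'i, 'e) config. C' \<approx>\<^sub>H\<^sub>a\<^sub>s\<^sub>c\<^sub>o D' \<Longrightarrow> sat C' \<phi> \<Longrightarrow> sat D' \<phi>"
  shows "sat D (DiaTau \<phi>)"
proof -
  obtain C' where C': "weak C ETau C'" "sat C' \<phi>"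
    using assms(2) by auto
  obtain D' where "weak D ETau D'" "C' \<approx>\<^sub>H\<^sub>a\<^sub>s\<^sub>c\<^sub>o D'"
    by (rule hasco_bisimilar_weak[OF bisim C'(1)]) simp
  with C'(2) transfer show ?thesis
    by auto
qed

lemma sat_DiaAct_transfer:
  fixes C D :: "('x, 'n, 'i, 'e) config"
  assumes bisim: "C \<approx>\<^sub>H\<^sub>a\<^sub>s\<^sub>c\<^sub>o D" and "sat C (DiaAct x a \<phi>)"
    and transfer: "\<And>l (C' :: ('x, 'n, 'i, 'e) config) D'. C' \<approx>\<^sub>H\<^sub>a\<^sub>s\<^sub>c\<^sub>o D' \<Longrightarrow> sat C' (fsubst l x \<phi>) \<Longrightarrow> sat D' (fsubst l x \<phi>)"
  shows "sat D (DiaAct x a \<phi>)"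
proof -
  obtain N where N: "finite (UNIV - N)"
    and N_sat: "\<forall>l \<in> N. \<exists>C'. weak C (EAct l a) C' \<and> sat C' (fsubst l x \<phi>)"
    using assms(2) by auto
  \<comment> \<open>These are the external names at which \<open>D\<close> need not match a step of
    \<open>C\<close>. The set is finite because \<open>ExT\<close> is injective.\<close>
  let ?U = "ExT -` config_names D"
  have "finite ?U"
    using hasco_bisimilar_ext_config[OF bisim]
    by (intro finite_vimageI finite_config_names) (auto simp: inj_def)
  moreover have "UNIV - (N - ?U) = (UNIV - N) \<union> ?U"
    by auto
  ultimately have "finite (UNIV - (N - ?U))"
    using N by simp
  moreover have "\<exists>D'. weak D (EAct l a) D' \<and> sat D' (fsubst l x \<phi>)" if l: "l \<in> N - ?U" for l
  proof -
    obtain C' where C': "weak C (EAct l a) C'" "sat C' (fsubst l x \<phi>)"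
      using N_sat l by blast
    obtain D' where "weak D (EAct l a) D'" "C' \<approx>\<^sub>H\<^sub>a\<^sub>s\<^sub>c\<^sub>o D'"
      \<comment> \<open>That \<open>l\<close> lies outside \<open>?U\<close> is exactly the
        freshness of the label for \<open>D\<close>.\<close>
      by (rule hasco_bisimilar_weak[OF bisim C'(1)]) (use l in auto)
    with C'(2) transfer show ?thesis
      by blast
  qed
  ultimately show ?thesis
    unfolding sat.simps by blast
qed

text \<open>Induction along the recursion of \<open>sat\<close> rather than on the structure of
  formulae, since the clause for \<open>DiaAct\<close> recurs on \<open>fsubst l x \<phi>\<close>.
  The equivalence, not just one implication, carries the induction through negation.\<close>

lemma hasco_bisimilar_sat:
  fixes C D :: "('x, 'n, 'i, 'e) config"
  shows "C \<approx>\<^sub>H\<^sub>a\<^sub>s\<^sub>c\<^sub>o D \<Longrightarrow> sat C \<phi> \<longleftrightarrow> sat D \<phi>"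
proof (induction C \<phi> arbitrary: D rule: sat.induct)
  case (1 C \<phi>)
  then show ?case
    by (meson sat_DiaTau_transfer hasco_bisimilar_sym)
next
  case (2 C x a \<phi>)
  have "C' \<approx>\<^sub>H\<^sub>a\<^sub>s\<^sub>c\<^sub>o D' \<Longrightarrow> sat C' (fsubst l x \<phi>) \<longleftrightarrow> sat D' (fsubst l x \<phi>)" for l and C' D' :: "('x, 'n, 'i, 'e) config"
    \<comment> \<open>The induction hypothesis is guarded by membership of \<open>l\<close> in an
      arbitrary set of names; choosing \<open>UNIV\<close> makes it available for every
      \<open>l\<close>.\<close>
    by (rule "2.IH"[of l UNIV]) simp_all
  with "2.prems" show ?case
    by (meson sat_DiaAct_transfer hasco_bisimilar_sym)
next
  case (3 C \<phi>)
  then show ?case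
    by simp
next
  case (4 C F)
  then show ?case
    by auto
next
  case (5 C k)
  then show ?case
    by (simp add: hasco_bisimilar_hasco)
next
  case (6 C x)
  then show ?case
    by simp
qed

theorem proposition4p4:
  fixes C1 C2 :: "('x::countable, 'n, 'i, 'e) config"
  assumes "infinite (UNIV :: 'n set)"
    and "infinite (UNIV :: 'i set)"
    and "infinite (UNIV :: 'e set)"
    and "ext_config C1"
    and "ext_config C2"
    and "C1 \<approx>\<^sub>H\<^sub>a\<^sub>s\<^sub>c\<^sub>o C2"
  shows "(logic_hasco C1 :: ('n, 'e, 'v::countable, 'k) fm set) = logic_hasco C2"
  unfolding logic_hasco_def using hasco_bisimilar_sat[OF assms(6)] by blast

end
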